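(* Let $X$ be a finite set with $|X|=n\geq 2$, let $\tau$ be the discrete topology on $X$, and let $G_\tau$ be the discrete topological graph of $X$. Then the minimum degree $\delta(G_\tau)$ and the maximum degree $\Delta(G_\tau)$ satisfy: (1) $\delta(G_\tau)=1$; (2) $\Delta(G_\tau)=n-1+\sum_{i=2}^{n-1}\binom{n-1}{i}$.
   Context: For a non-empty set $X$ with the discrete topology $\tau$ (so $\tau$ is the family of all subsets of $X$), the discrete topological graph $G_\tau=(V,E)$ is the simple undirected graph with vertex set $V=\{A\in\tau : A\neq\emptyset,\ A\neq X\}$ in which two vertices $A,B$ are adjacent if and only if $A\cap B=\emptyset$. An empty sum equals $0$. *)

theory Defs
  imports "HOL-Analysis.Abstract_Topology"
begin

(* A simple undirected graph is a pair (V, E) whose edges are two-element subsets of V. *)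
type_synonym 'v ugraph = "'v set \<times> 'v set set"

definition simple_graph :: "'v ugraph \<Rightarrow> bool" where
  "simple_graph G \<longleftrightarrow> (\<forall>e\<in>snd G. e \<subseteq> fst G \<and> card e = 2)"

definition degree :: "'v ugraph \<Rightarrow> 'v \<Rightarrow> nat" where
  "degree G v = card {e \<in> snd G. v \<in> e}"

(* Min and Max are meaningful for a finite non-empty vertex set. *)
definition min_degree :: "'v ugraph \<Rightarrow> nat" where
  "min_degree G = Min (degree G ` fst G)"

definition max_degree :: "'v ugraph \<Rightarrow> nat" where
  "max_degree G = Max (degree G ` fst G)"

definition dtg_verts :: "'a set \<Rightarrow> 'a set set" where
  "dtg_verts X = {A. openin (discrete_topology X) A \<and> A \<noteq> {} \<and> A \<noteq> X}"

definition dtg_edges :: "'a set \<Rightarrow> 'a set set set" where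
  "dtg_edges X = {{A, B} | A B. A \<in> dtg_verts X \<and> B \<in> dtg_verts X \<and> A \<inter> B = {}}"

definition discrete_topological_graph :: "'a set \<Rightarrow> 'a set ugraph" where
  "discrete_topological_graph X = (dtg_verts X, dtg_edges X)"

(* Disjoint vertices are distinct because vertices are non-empty, so there are no loops. *)
lemma simple_graph_discrete_topological_graph:
  "simple_graph (discrete_topological_graph X)"
proof -
  have "A \<noteq> B" if "A \<in> dtg_verts X" "A \<inter> B = {}" for A B :: "'a set"
    using that by (auto simp: dtg_verts_def)
  then show ?thesis
    by (fastforce simp: simple_graph_def discrete_topological_graph_def dtg_edges_def card_2_iff)
qed

lemma discrete_topological_graph_adjacent_iff:
  assumes "A \<in> fst (discrete_topological_graph X)" "B \<in> fst (discrete_topological_graph X)"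
  shows "{A, B} \<in> snd (discrete_topological_graph X) \<longleftrightarrow> A \<inter> B = {}"
  using assms by (auto simp: discrete_topological_graph_def dtg_edges_def doubleton_eq_iff)

end

theory Submission
  imports Defs
begin

text \<open>
  The neighbours of a vertex \<open>A\<close> are exactly the non-empty subsets of its complement: such a set
  misses \<open>A \<noteq> {}\<close>, so it is automatically a proper subset of \<open>X\<close>. Hence \<open>A\<close> has degree
  \<open>2 ^ (n - |A|) - 1\<close>, which decreases strictly in \<open>|A|\<close>. Since \<open>|A|\<close> runs from \<open>1\<close> to \<open>n - 1\<close>, the
  minimum is \<open>2 ^ 1 - 1 = 1\<close>, attained at complements of points, and the maximum is
  \<open>2 ^ (n - 1) - 1\<close>, attained at singletons. The stated form of the maximum counts the non-empty
  subsets of an \<open>(n - 1)\<close>-element set by their size.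
\<close>

lemma mem_dtg_verts_iff: "A \<in> dtg_verts X \<longleftrightarrow> A \<subseteq> X \<and> A \<noteq> {} \<and> A \<noteq> X"
  by (simp add: dtg_verts_def)

lemma dtg_edges_containing:
  assumes "A \<in> dtg_verts X"
  shows "{e \<in> dtg_edges X. A \<in> e} = (\<lambda>B. {A, B}) ` (Pow (X - A) - {{}})"
proof (intro equalityI subsetI)
  fix e assume "e \<in> {e \<in> dtg_edges X. A \<in> e}"
  then obtain B where "e = {A, B}" "B \<in> dtg_verts X" "A \<inter> B = {}"
    by (auto simp: dtg_edges_def)
  then show "e \<in> (\<lambda>B. {A, B}) ` (Pow (X - A) - {{}})"
    by (auto simp: mem_dtg_verts_iff)
next
  fix e assume "e \<in> (\<lambda>B. {A, B}) ` (Pow (X - A) - {{}})"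
  then obtain B where e: "e = {A, B}" and B: "B \<subseteq> X - A" "B \<noteq> {}"
    by auto
  from assms B have "B \<in> dtg_verts X" "A \<inter> B = {}"
    by (auto simp: mem_dtg_verts_iff)
  with assms e show "e \<in> {e \<in> dtg_edges X. A \<in> e}"
    by (auto simp: dtg_edges_def)
qed

lemma degree_discrete_topological_graph:
  assumes "finite X" and "A \<in> dtg_verts X"
  shows "degree (discrete_topological_graph X) A = 2 ^ (card X - card A) - 1"
proof -
  have "A \<subseteq> X" "finite A"
    using assms by (auto simp: mem_dtg_verts_iff intro: finite_subset)
  have "inj_on (\<lambda>B. {A, B}) (Pow (X - A) - {{}})"
    by (auto simp: inj_on_def doubleton_eq_iff)
  then have "degree (discrete_topological_graph X) A = card (Pow (X - A) - {{}})"
    using assms(2)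
    by (simp add: degree_def discrete_topological_graph_def dtg_edges_containing card_image)
  also have "\<dots> = 2 ^ card (X - A) - 1"
    using assms(1) by (simp add: card_Diff_singleton card_Pow)
  also have "card (X - A) = card X - card A"
    using \<open>A \<subseteq> X\<close> \<open>finite A\<close> by (simp add: card_Diff_subset)
  finally show ?thesis .
qed

lemma card_dtg_vert_bounds:
  assumes "finite X" and "A \<in> dtg_verts X"
  shows "1 \<le> card A" and "card A < card X"
proof -
  have "A \<subset> X" "A \<noteq> {}"
    using assms(2) by (auto simp: mem_dtg_verts_iff)
  moreover have "finite A"
    using \<open>A \<subset> X\<close> assms(1) by (auto intro: finite_subset)
  ultimately show "1 \<le> card A" and "card A < card X"
    using assms(1) by (auto simp: Suc_le_eq card_gt_0_iff intro: psubset_card_mono)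
qed

lemma finite_dtg_verts:
  assumes "finite X"
  shows "finite (dtg_verts X)"
  by (rule finite_subset[of _ "Pow X"]) (use assms in \<open>auto simp: mem_dtg_verts_iff\<close>)

text \<open>Every vertex misses at least one point, and a vertex missing exactly one point has that
  point as its only neighbour.\<close>
lemma min_degree_discrete_topological_graph:
  assumes "finite X" and "card X \<ge> 2"
  shows "min_degree (discrete_topological_graph X) = 1"
proof -
  let ?G = "discrete_topological_graph X"
  obtain x where x: "x \<in> X"
    using assms(2) by fastforce
  have card_co: "card (X - {x}) = card X - 1"
    using assms(1) x by simp
  then have "X - {x} \<noteq> {}"
    using assms(2) by (metis card.empty diff_is_0_eq not_less_eq_eq numeral_2_eq_2 One_nat_def)
  then have co: "X - {x} \<in> dtg_verts X"
    using x by (auto simp: mem_dtg_verts_iff)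
  have "Min (degree ?G ` dtg_verts X) = 1"
  proof (rule Min_eqI)
    show "finite (degree ?G ` dtg_verts X)"
      using assms(1) by (simp add: finite_dtg_verts)
  next
    fix d assume "d \<in> degree ?G ` dtg_verts X"
    then obtain A where A: "A \<in> dtg_verts X" "d = 2 ^ (card X - card A) - 1"
      using assms(1) by (auto simp: degree_discrete_topological_graph)
    have "(2::nat) ^ 1 \<le> 2 ^ (card X - card A)"
      using card_dtg_vert_bounds(2)[OF assms(1) A(1)] by (intro power_increasing) auto
    with A(2) show "1 \<le> d"
      by simp
  next
    have "degree ?G (X - {x}) = 1"
      using degree_discrete_topological_graph[OF assms(1) co] card_co assms(2) by simp
    with co show "1 \<in> degree ?G ` dtg_verts X"
      by force
  qed
  then show ?thesis
    by (simp add: min_degree_def discrete_topological_graph_def)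
qed

text \<open>A smaller vertex leaves a larger complement, so the maximum is attained at singletons.\<close>
lemma max_degree_discrete_topological_graph:
  assumes "finite X" and "card X \<ge> 2"
  shows "max_degree (discrete_topological_graph X) = 2 ^ (card X - 1) - 1"
proof -
  let ?G = "discrete_topological_graph X"
  obtain x where x: "x \<in> X"
    using assms(2) by fastforce
  have sing: "{x} \<in> dtg_verts X"
    using x assms(2) by (auto simp: mem_dtg_verts_iff)
  have "Max (degree ?G ` dtg_verts X) = 2 ^ (card X - 1) - 1"
  proof (rule Max_eqI)
    show "finite (degree ?G ` dtg_verts X)"
      using assms(1) by (simp add: finite_dtg_verts)
  next
    fix d assume "d \<in> degree ?G ` dtg_verts X"
    then obtain A where A: "A \<in> dtg_verts X" "d = 2 ^ (card X - card A) - 1"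
      using assms(1) by (auto simp: degree_discrete_topological_graph)
    have "(2::nat) ^ (card X - card A) \<le> 2 ^ (card X - 1)"
      using card_dtg_vert_bounds(1)[OF assms(1) A(1)] by (intro power_increasing) auto
    with A(2) show "d \<le> 2 ^ (card X - 1) - 1"
      by (simp only: diff_le_mono)
  next
    show "2 ^ (card X - 1) - 1 \<in> degree ?G ` dtg_verts X"
      using degree_discrete_topological_graph[OF assms(1) sing] sing by force
  qed
  then show ?thesis
    by (simp add: max_degree_def discrete_topological_graph_def)
qed

text \<open>Split the row sum \<open>2 ^ m\<close> of Pascal's triangle into the terms \<open>1\<close> and \<open>m\<close>, for the empty set
  and the singletons, and the rest.\<close>
lemma two_power_minus_one_eq_sum_choose:
  fixes m :: nat
  assumes "m \<ge> 1"
  shows "2 ^ m - 1 = m + (\<Sum>i=2..m. m choose i)"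
proof -
  have "2 ^ m = (\<Sum>i=0..m. m choose i)"
    by (simp add: choose_row_sum atLeast0AtMost)
  also have "\<dots> = 1 + (\<Sum>i=1..m. m choose i)"
    by (simp add: sum.atLeast_Suc_atMost)
  also have "(\<Sum>i=1..m. m choose i) = m + (\<Sum>i=2..m. m choose i)"
    using assms by (simp add: sum.atLeast_Suc_atMost numeral_2_eq_2)
  finally show ?thesis
    by simp
qed

theorem theorem2p4:
  fixes X :: "'a set" and n :: nat
  assumes "finite X" and "card X = n" and "n \<ge> 2"
  shows "min_degree (discrete_topological_graph X) = 1
    \<and> max_degree (discrete_topological_graph X) = n - 1 + (\<Sum>i=2..n-1. (n - 1) choose i)"
  using assms min_degree_discrete_topological_graph[of X]
    max_degree_discrete_topological_graph[of X] two_power_minus_one_eq_sum_choose[of "n - 1"]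
  by simp

end
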